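(* Let $K \subset \mathbb{R}^d$ be a circumscribed centrally symmetric convex polytope with centre of symmetry $O$. Let $X, X'$ be uniformly distributed random points in $K$ and $Y, Y'$ uniformly distributed random points on $\partial K$, all independent. Then $$\mathbb{E}|XX'|^2 = \frac{d}{d+1}\,\mathbb{E}|XY|^2 = \frac{2d}{d+2}\,\mathbb{E}|OY|^2 = \frac{d}{d+2}\,\mathbb{E}|YY'|^2.$$
   Context: Polytopes are assumed to have non-empty interior. A polytope is circumscribed if there is a sphere inscribed in it, i.e. a ball contained in it that is tangent to the hyperplane spanned by each of its facets. "Uniform in $K$" is with respect to Lebesgue measure; "uniform on $\partial K$" is with respect to $(d-1)$-dimensional surface measure. $|AB|$ denotes Euclidean distance. *)

theory Defs
  imports "HOL-Probability.Probability"
begin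

definition centrally_symmetric :: "'a::euclidean_space set \<Rightarrow> 'a \<Rightarrow> bool" where
  "centrally_symmetric K c \<longleftrightarrow> (\<lambda>x. 2 *\<^sub>R c - x) ` K = K"

(* Asking for a single common point would be wrong in dimension 1, where every
   hyperplane is a point and so meets any set in at most one point. *)
definition tangent_hyperplane :: "'a::euclidean_space set \<Rightarrow> 'a \<Rightarrow> real \<Rightarrow> bool" where
  "tangent_hyperplane H z r \<longleftrightarrow> H \<inter> cball z r \<noteq> {} \<and> H \<inter> ball z r = {}"

definition circumscribed :: "'a::euclidean_space set \<Rightarrow> bool" where
  "circumscribed K \<longleftrightarrow>
     (\<exists>z r. 0 < r \<and> cball z r \<subseteq> K \<and> (\<forall>F. F facet_of K \<longrightarrow> tangent_hyperplane (affine hull F) z r))"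

definition orthonormal_frame :: "'a::euclidean_space set \<Rightarrow> 'a \<Rightarrow> 'a set \<Rightarrow> bool" where
  "orthonormal_frame S p B \<longleftrightarrow>
     pairwise orthogonal B \<and> (\<forall>b\<in>B. norm b = 1) \<and> S = (\<lambda>v. p + v) ` span B"

(* Push-forward of k-dimensional Lebesgue measure along the isometric chart given by a frame;
   compare the definition of lborel, where p = 0 and B = Basis. If S is a single point then
   B = {} and the measure is a unit point mass (0-dimensional measure). *)
definition frame_lborel :: "'a::euclidean_space \<Rightarrow> 'a set \<Rightarrow> 'a measure" where
  "frame_lborel p B = distr (\<Pi>\<^sub>M b\<in>B. lborel) borel (\<lambda>f. p + (\<Sum>b\<in>B. f b *\<^sub>R b))"

(* k-dimensional Lebesgue measure on a k-dimensional affine subspace S. The choice of the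
   frame is immaterial since Lebesgue measure is invariant under isometries. *)
definition affine_lborel :: "'a::euclidean_space set \<Rightarrow> 'a measure" where
  "affine_lborel S = (SOME \<mu>. \<exists>p B. orthonormal_frame S p B \<and> \<mu> = frame_lborel p B)"

(* For a d-dimensional polytope K this is (d-1)-dimensional area on the boundary:
   distinct facets overlap only in sets of area zero. *)
definition surface_measure :: "'a::euclidean_space set \<Rightarrow> 'a measure" where
  "surface_measure K = measure_of UNIV (sets borel)
     (\<lambda>A. \<Sum>F | F facet_of K. emeasure (affine_lborel (affine hull F)) (A \<inter> F))"

lemma frame_lborel_exists:
  fixes S :: "'a::euclidean_space set"
  assumes "affine S" "S \<noteq> {}"
  shows "\<exists>p B. orthonormal_frame S p B"
proof -
  obtain p where p: "p \<in> S" using assms(2) by auto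
  define T where "T = (\<lambda>x. - p + x) ` S"
  have T: "subspace T"
    unfolding T_def by (rule affine_diffs_subspace[OF assms(1) p])
  obtain B where B: "pairwise orthogonal B" "\<And>x. x \<in> B \<Longrightarrow> norm x = 1" "span B = T"
    using orthonormal_basis_subspace[OF T] by metis
  have "S = (\<lambda>v. p + v) ` span B"
    unfolding B(3) T_def image_image by simp
  with B show ?thesis unfolding orthonormal_frame_def by blast
qed

lemma affine_lborel_frame:
  fixes S :: "'a::euclidean_space set"
  assumes "affine S" "S \<noteq> {}"
  shows "\<exists>p B. orthonormal_frame S p B \<and> affine_lborel S = frame_lborel p B"
  unfolding affine_lborel_def
  by (rule someI_ex) (use frame_lborel_exists[OF assms] in blast)

lemma sets_affine_lborel:
  fixes S :: "'a::euclidean_space set"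
  assumes "affine S" "S \<noteq> {}"
  shows "sets (affine_lborel S) = sets borel"
  using affine_lborel_frame[OF assms] by (auto simp: frame_lborel_def)

lemma sets_surface_measure [simp, measurable_cong]: "sets (surface_measure K) = sets borel"
  unfolding surface_measure_def
  using sets.sigma_sets_eq[of borel] by (simp add: sets_measure_of_conv)

lemma space_surface_measure [simp]: "space (surface_measure K) = UNIV"
  by (simp add: surface_measure_def space_measure_of_conv)

lemma emeasure_surface_measure:
  fixes K :: "'a::euclidean_space set"
  assumes K: "polytope K" and A: "A \<in> sets borel"
  shows "emeasure (surface_measure K) A =
    (\<Sum>F | F facet_of K. emeasure (affine_lborel (affine hull F)) (A \<inter> F))"
proof -
  have S: "sets (affine_lborel (affine hull F)) = sets borel" and F: "F \<in> sets borel"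
    if "F facet_of K" for F
  proof -
    show "sets (affine_lborel (affine hull F)) = sets borel"
      using that by (intro sets_affine_lborel) (auto simp: facet_of_def)
    have "closed F"
      using K that face_of_polytope_polytope facet_of_imp_face_of polytope_imp_closed by blast
    then show "F \<in> sets borel" by auto
  qed
  show ?thesis
  proof (rule emeasure_measure_of[OF surface_measure_def])
    show "countably_additive (sets (surface_measure K))
      (\<lambda>A. \<Sum>F | F facet_of K. emeasure (affine_lborel (affine hull F)) (A \<inter> F))"
    proof (rule countably_additiveI)
      fix D :: "nat \<Rightarrow> 'a set"
      assume D: "range D \<subseteq> sets (surface_measure K)" "disjoint_family D"
      have "(\<Sum>i. emeasure (affine_lborel (affine hull F)) (D i \<inter> F)) =
          emeasure (affine_lborel (affine hull F)) ((\<Union>i. D i) \<inter> F)" if "F facet_of K" for F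
      proof -
        have "range (\<lambda>i. D i \<inter> F) \<subseteq> sets (affine_lborel (affine hull F))"
          using D(1) S[OF that] F[OF that] by auto
        moreover have "disjoint_family (\<lambda>i. D i \<inter> F)"
          using D(2) by (auto simp: disjoint_family_on_def)
        ultimately show ?thesis
          by (subst suminf_emeasure) (auto simp: Int_UN_distrib2)
      qed
      then show "(\<Sum>i. \<Sum>F | F facet_of K. emeasure (affine_lborel (affine hull F)) (D i \<inter> F)) =
          (\<Sum>F | F facet_of K. emeasure (affine_lborel (affine hull F)) (\<Union> (range D) \<inter> F))"
        by (subst suminf_sum) auto
    qed
  qed (use A in \<open>auto simp: positive_def\<close>)
qed

end

(* The inscribed ball is centred at the centre of symmetry c, so K decomposes, up to a null set, into
   pyramids with apex c over the facets, all of the same height r. For a nonnegative function that is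
   homogeneous of degree k about c, integrating the pyramids layer by layer gives
     (integral over K) = r / (d + k) * (integral over the boundary).
   Comparing with k = 0 yields E g(X) = d / (d + k) * E g(Y); k = 1 shows that Y has mean c like X,
   and k = 2 relates the second moments A of X and B of Y about c by A = d / (d + 2) * B. By
   independence the expected squared distances are 2 A, A + B and 2 B. *)
theory Submission
  imports Defs
begin

text \<open>\<open>affine_lborel\<close> takes its frame by choice, so all that is known about the
  coordinates on a facet is that they are orthonormal. Slicing a pyramid in such coordinates
  requires Lebesgue measure to factor over every orthonormal basis, not just over
  \<open>Basis\<close>. This is drawn from the uniqueness of translation invariant measures, with a
  Gaussian fixing the constant. Homogeneous functions are integrated with values in
  \<open>ennreal\<close>, which avoids integrability questions; a linear form enters through its
  positive part, again homogeneous of degree 1. This is also how the mean passes from the body to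
  its boundary: reflecting the surface measure directly would mean comparing the chosen frames of
  opposite facets.\<close>

section \<open>Lebesgue measure in orthonormal coordinates\<close>

lemma borel_measurable_PiM_coordinate_sum [measurable]:
  "(\<lambda>f. \<Sum>b\<in>B. f b *\<^sub>R (b::'a::euclidean_space)) \<in> borel_measurable (\<Pi>\<^sub>M b\<in>B. lborel)"
  by (intro borel_measurable_sum borel_measurable_scaleR) auto

text \<open>Substituting one coordinate at a time contributes one factor \<open>t\<close> each. The
  case t = 1 gives translation invariance in a frame; t = s / h compares a layer of a pyramid with
  its base. The restricted lambda keeps the argument extensional, as points of a product space
  are.\<close>

lemma nn_integral_PiM_lborel_affine:
  fixes k :: "('i \<Rightarrow> real) \<Rightarrow> ennreal"
  assumes "finite B" "t > 0" "k \<in> borel_measurable (\<Pi>\<^sub>M b\<in>B. lborel)"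
  shows "(\<integral>\<^sup>+f. k f \<partial>(\<Pi>\<^sub>M b\<in>B. lborel)) =
    ennreal (t ^ card B) * (\<integral>\<^sup>+f. k (\<lambda>b\<in>B. a b + t * f b) \<partial>(\<Pi>\<^sub>M b\<in>B. lborel))"
  using assms(1,3)
proof (induction B arbitrary: k rule: finite_induct)
  case empty
  then show ?case by (simp add: space_PiM PiM_empty nn_integral_count_space_finite)
next
  case (insert i B)
  interpret product_sigma_finite "\<lambda>_. lborel :: real measure" ..
  interpret finite_product_sigma_finite "\<lambda>_. lborel :: real measure" B
    by standard (rule insert.hyps)
  note [measurable] = insert.prems
  have upd: "(\<lambda>b\<in>insert i B. a b + t * (x(i := y)) b) = (\<lambda>b\<in>B. a b + t * x b)(i := a i + t * y)"
    for x y using insert.hyps by (auto simp: fun_eq_iff)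
  have "(\<integral>\<^sup>+f. k f \<partial>(\<Pi>\<^sub>M b\<in>insert i B. lborel)) =
      (\<integral>\<^sup>+y. (\<integral>\<^sup>+x. k (x(i := y)) \<partial>(\<Pi>\<^sub>M b\<in>B. lborel)) \<partial>lborel)"
    using insert.hyps by (intro product_nn_integral_insert_rev) auto
  also have "\<dots> = (\<integral>\<^sup>+y. ennreal (t ^ card B) *
      (\<integral>\<^sup>+x. k ((\<lambda>b\<in>B. a b + t * x b)(i := y)) \<partial>(\<Pi>\<^sub>M b\<in>B. lborel)) \<partial>lborel)"
    by (intro nn_integral_cong insert.IH) measurable
  also have "\<dots> = ennreal t * (\<integral>\<^sup>+y. ennreal (t ^ card B) *
      (\<integral>\<^sup>+x. k ((\<lambda>b\<in>B. a b + t * x b)(i := a i + t * y)) \<partial>(\<Pi>\<^sub>M b\<in>B. lborel)) \<partial>lborel)"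
  proof -
    have "(\<lambda>y. ennreal (t ^ card B) * (\<integral>\<^sup>+x. k ((\<lambda>b\<in>B. a b + t * x b)(i := y)) \<partial>(\<Pi>\<^sub>M b\<in>B. lborel)))
        \<in> borel_measurable lborel"
      by measurable
    then show ?thesis
      using \<open>t > 0\<close> by (subst nn_integral_real_affine[where c = t and t = "a i"]) auto
  qed
  also have "\<dots> = ennreal t * (ennreal (t ^ card B) *
      (\<integral>\<^sup>+y. (\<integral>\<^sup>+x. k ((\<lambda>b\<in>B. a b + t * x b)(i := a i + t * y)) \<partial>(\<Pi>\<^sub>M b\<in>B. lborel)) \<partial>lborel))"
    by (subst nn_integral_cmult) auto
  also have "(\<integral>\<^sup>+y. (\<integral>\<^sup>+x. k ((\<lambda>b\<in>B. a b + t * x b)(i := a i + t * y)) \<partial>(\<Pi>\<^sub>M b\<in>B. lborel)) \<partial>lborel)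
      = (\<integral>\<^sup>+f. k (\<lambda>b\<in>insert i B. a b + t * f b) \<partial>(\<Pi>\<^sub>M b\<in>insert i B. lborel))"
    unfolding upd[symmetric]
    using insert.hyps by (intro product_nn_integral_insert_rev[symmetric]) auto
  finally show ?case
    using insert.hyps \<open>t > 0\<close> by (simp add: ennreal_mult' mult.assoc del: restrict_apply)
qed

text \<open>Uniqueness of Haar measure, by the classical Fubini argument.\<close>
lemma nn_integral_translation_invariant_lborel:
  fixes \<mu> :: "'a::euclidean_space measure"
  assumes "sigma_finite_measure \<mu>" and [measurable_cong]: "sets \<mu> = sets borel"
    and inv: "\<And>f a. f \<in> borel_measurable borel \<Longrightarrow> (\<integral>\<^sup>+x. f (x + a) \<partial>\<mu>) = (\<integral>\<^sup>+x. f x \<partial>\<mu>)"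
    and [measurable]: "f \<in> borel_measurable borel" "g \<in> borel_measurable borel"
  shows "(\<integral>\<^sup>+x. f x \<partial>\<mu>) * (\<integral>\<^sup>+x. g x \<partial>lborel) = (\<integral>\<^sup>+x. g x \<partial>\<mu>) * (\<integral>\<^sup>+x. f x \<partial>lborel)"
proof -
  interpret sigma_finite_measure \<mu> by fact
  interpret P: pair_sigma_finite \<mu> lborel ..
  \<comment> \<open>Both uses have Jacobian 1: c = 1 shifts the inner variable by x, c = -1
    exchanges y and x - y.\<close>
  have aff: "(\<integral>\<^sup>+y. h y \<partial>lborel) = (\<integral>\<^sup>+y. h (t + c *\<^sub>R y) \<partial>lborel)"
    if [measurable]: "h \<in> borel_measurable borel" and c: "\<bar>c\<bar> = 1"
    for h :: "'a \<Rightarrow> ennreal" and t c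
    using c by (subst lborel_affine[of c t]) (auto simp: nn_integral_density nn_integral_distr)
  have "(\<integral>\<^sup>+x. f x \<partial>\<mu>) * (\<integral>\<^sup>+x. g x \<partial>lborel) = (\<integral>\<^sup>+x. f x * (\<integral>\<^sup>+y. g y \<partial>lborel) \<partial>\<mu>)"
    by (simp add: nn_integral_multc)
  also have "\<dots> = (\<integral>\<^sup>+x. (\<integral>\<^sup>+y. f x * g (x + y) \<partial>lborel) \<partial>\<mu>)"
    using aff[of g 1] by (simp add: nn_integral_cmult)
  also have "\<dots> = (\<integral>\<^sup>+y. (\<integral>\<^sup>+x. f x * g (x + y) \<partial>\<mu>) \<partial>lborel)"
    by (rule P.Fubini'[symmetric]) measurable
  also have "\<dots> = (\<integral>\<^sup>+y. (\<integral>\<^sup>+x. f (x - y) * g x \<partial>\<mu>) \<partial>lborel)"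
  proof (rule nn_integral_cong)
    fix y
    show "(\<integral>\<^sup>+x. f x * g (x + y) \<partial>\<mu>) = (\<integral>\<^sup>+x. f (x - y) * g x \<partial>\<mu>)"
      using inv[of "\<lambda>x. f (x - y) * g x" y] by simp
  qed
  also have "\<dots> = (\<integral>\<^sup>+x. (\<integral>\<^sup>+y. f (x - y) * g x \<partial>lborel) \<partial>\<mu>)"
    by (rule P.Fubini') measurable
  also have "\<dots> = (\<integral>\<^sup>+x. (\<integral>\<^sup>+y. f y \<partial>lborel) * g x \<partial>\<mu>)"
    using aff[of f "-1"] by (simp add: nn_integral_multc)
  also have "\<dots> = (\<integral>\<^sup>+x. g x \<partial>\<mu>) * (\<integral>\<^sup>+x. f x \<partial>lborel)"
    by (subst nn_integral_cmult) (auto simp: mult.commute)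
  finally show ?thesis .
qed

lemma norm_orthonormal_sum:
  assumes "pairwise orthogonal C" "\<And>b. b \<in> C \<Longrightarrow> norm b = 1" "finite C"
  shows "(norm (\<Sum>b\<in>C. f b *\<^sub>R b))\<^sup>2 = (\<Sum>b\<in>C. (f b)\<^sup>2)"
  using assms
  by (subst norm_sum_Pythagorean) (auto simp: pairwise_def orthogonal_clauses power_mult_distrib)

text \<open>Its integral factorises in every orthonormal basis; this fixes the constant in the uniqueness
  of Haar measure.\<close>
definition gaussian :: "'a::euclidean_space \<Rightarrow> real" where
  "gaussian x = (1 / sqrt (2 * pi)) ^ DIM('a) * exp (- (norm x)\<^sup>2 / 2)"

lemma borel_measurable_gaussian [measurable]: "gaussian \<in> borel_measurable borel"
  unfolding gaussian_def by measurable

lemma nn_integral_gaussian_frame: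
  fixes C :: "'a::euclidean_space set"
  assumes C: "pairwise orthogonal C" "\<And>b. b \<in> C \<Longrightarrow> norm b = 1" "finite C" "card C = DIM('a)"
  shows "(\<integral>\<^sup>+f. ennreal (gaussian (\<Sum>b\<in>C. f b *\<^sub>R b)) \<partial>(\<Pi>\<^sub>M b\<in>C. lborel)) = 1"
proof -
  interpret product_sigma_finite "\<lambda>_. lborel :: real measure" ..
  have "gaussian (\<Sum>b\<in>C. f b *\<^sub>R b) = (\<Prod>b\<in>C. std_normal_density (f b))" for f
    unfolding gaussian_def std_normal_density_def
    by (simp add: norm_orthonormal_sum C prod.distrib sum_negf sum_divide_distrib power_one_over
        del: times_divide_eq_left times_divide_eq_right flip: exp_sum[OF C(3)])
  then have "(\<integral>\<^sup>+f. ennreal (gaussian (\<Sum>b\<in>C. f b *\<^sub>R b)) \<partial>(\<Pi>\<^sub>M b\<in>C. lborel)) =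
      (\<integral>\<^sup>+f. (\<Prod>b\<in>C. ennreal (std_normal_density (f b))) \<partial>(\<Pi>\<^sub>M b\<in>C. lborel))"
    by (simp add: prod_ennreal)
  also have "\<dots> = (\<Prod>b\<in>C. (\<integral>\<^sup>+x. ennreal (std_normal_density x) \<partial>lborel))"
    using C(3) by (intro product_nn_integral_prod) auto
  also have "\<dots> = 1"
    by (subst nn_integral_eq_integral) (auto intro: integrable_normal_density)
  finally show ?thesis .
qed

lemma
  fixes C :: "'a::euclidean_space set"
  assumes C: "pairwise orthogonal C" "\<And>b. b \<in> C \<Longrightarrow> norm b = 1" "card C = DIM('a)"
  shows finite_orthonormal_basis: "finite C"
    and span_orthonormal_basis: "x \<in> span C"
proof -
  show "finite C"
    using C(3) DIM_positive by (intro card_ge_0_finite) auto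
  have "0 \<notin> C" using C(2) by force
  then have "independent C" using C(1) pairwise_orthogonal_independent by blast
  then show "x \<in> span C"
    using C(3) card_ge_dim_independent[of C UNIV] by auto
qed

text \<open>Rotation invariance of Lebesgue measure. The image of the product measure under the
  chart is translation invariant, hence a multiple of \<open>lborel\<close>; the Gaussian has
  integral 1 for both, so the multiple is 1.\<close>

lemma nn_integral_lborel_frame:
  fixes C :: "'a::euclidean_space set"
  assumes C: "pairwise orthogonal C" "\<And>b. b \<in> C \<Longrightarrow> norm b = 1" "card C = DIM('a)"
    and [measurable]: "f \<in> borel_measurable borel"
  shows "(\<integral>\<^sup>+x. f x \<partial>lborel) = (\<integral>\<^sup>+v. f (\<Sum>b\<in>C. v b *\<^sub>R b) \<partial>(\<Pi>\<^sub>M b\<in>C. lborel))"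
proof -
  note fin = finite_orthonormal_basis[OF C] and span = span_orthonormal_basis[OF C]
  define \<mu> where "\<mu> = distr (\<Pi>\<^sub>M b\<in>C. lborel) borel (\<lambda>v. \<Sum>b\<in>C. v b *\<^sub>R b)"
  have [measurable_cong, simp]: "sets \<mu> = sets borel" by (simp add: \<mu>_def)
  have int: "(\<integral>\<^sup>+x. g x \<partial>\<mu>) = (\<integral>\<^sup>+v. g (\<Sum>b\<in>C. v b *\<^sub>R b) \<partial>(\<Pi>\<^sub>M b\<in>C. lborel))"
    if "g \<in> borel_measurable borel" for g
    unfolding \<mu>_def using that by (intro nn_integral_distr) auto
  have gauss: "(\<integral>\<^sup>+x. ennreal (gaussian x) \<partial>\<mu>) = 1"
    using nn_integral_gaussian_frame[OF C(1,2) fin C(3)] by (subst int) auto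
  have gauss': "(\<integral>\<^sup>+x. ennreal (gaussian (x::'a)) \<partial>lborel) = 1"
    using nn_integral_gaussian_frame[of "Basis :: 'a set"]
    by (subst lborel_eq, subst nn_integral_distr)
      (auto simp: pairwise_def orthogonal_def inner_not_same_Basis)
  \<comment> \<open>The uniqueness argument rests on Fubini. On each ball about 0 the Gaussian is at
    least a positive constant, so its finite integral bounds the measure of the ball.\<close>
  have "sigma_finite_measure \<mu>"
  proof
    have "emeasure \<mu> (cball 0 (real n)) \<noteq> \<infinity>" for n
    proof -
      define e where "e = (1 / sqrt (2 * pi)) ^ DIM('a) * exp (- (real n)\<^sup>2 / 2)"
      have e: "e > 0" by (simp add: e_def)
      have le: "e * indicator (cball 0 (real n)) x \<le> gaussian x" for x :: 'a
        by (auto simp: e_def gaussian_def indicator_def intro!: mult_left_mono power_mono)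
      have "ennreal e * emeasure \<mu> (cball 0 (real n)) = (\<integral>\<^sup>+x. ennreal e * indicator (cball 0 (real n)) x \<partial>\<mu>)"
        by (simp add: nn_integral_cmult_indicator)
      also have "\<dots> \<le> (\<integral>\<^sup>+x. ennreal (gaussian x) \<partial>\<mu>)"
      proof (intro nn_integral_mono)
        fix x :: 'a
        show "ennreal e * indicator (cball 0 (real n)) x \<le> ennreal (gaussian x)"
          using le[of x] e by (auto simp: indicator_def ennreal_leI split: if_splits)
      qed
      also have "\<dots> = 1" by (rule gauss)
      finally show ?thesis
        using e by (auto simp: ennreal_mult_top top_unique)
    qed
    moreover have "(\<Union>n. cball (0::'a) (real n)) = UNIV"
      using real_arch_simple by (fastforce simp: dist_norm)
    moreover have "space \<mu> = UNIV" by (simp add: \<mu>_def)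
    ultimately show "\<exists>A. countable A \<and> A \<subseteq> sets \<mu> \<and> \<Union> A = space \<mu> \<and> (\<forall>a\<in>A. emeasure \<mu> a \<noteq> \<infinity>)"
      by (intro exI[of _ "range (\<lambda>n. cball 0 (real n))"]) auto
  qed
  \<comment> \<open>Adding \<open>a\<close> to a point shifts its coordinates by the inner products
    \<open>a \<bullet> b\<close>.\<close>
  moreover have "(\<integral>\<^sup>+x. g (x + a) \<partial>\<mu>) = (\<integral>\<^sup>+x. g x \<partial>\<mu>)"
    if [measurable]: "g \<in> borel_measurable borel" for g and a :: 'a
  proof -
    have "(\<Sum>b\<in>C. v b *\<^sub>R b) + a = (\<Sum>b\<in>C. (a \<bullet> b + 1 * v b) *\<^sub>R b)" for v
      using orthonormal_basis_expand[OF C(1,2) span fin, of a]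
      by (simp add: scaleR_add_left sum.distrib)
    then show ?thesis
      using nn_integral_PiM_lborel_affine[OF fin, of 1 "\<lambda>v. g (\<Sum>b\<in>C. v b *\<^sub>R b)" "\<lambda>b. a \<bullet> b"]
      by (simp add: int)
  qed
  ultimately show ?thesis
    using nn_integral_translation_invariant_lborel[of \<mu> f gaussian] gauss gauss' int[of f]
    by simp
qed

section \<open>Integration over a pyramid\<close>

lemma nn_integral_lborel_translation:
  fixes f :: "'a::euclidean_space \<Rightarrow> ennreal"
  assumes [measurable]: "f \<in> borel_measurable borel"
  shows "(\<integral>\<^sup>+x. f x \<partial>lborel) = (\<integral>\<^sup>+x. f (z + x) \<partial>lborel)"
  by (subst lborel_affine[of 1 z]) (auto simp: nn_integral_density nn_integral_distr)

text \<open>For m = (d - 1) + k, the area of a layer and the degree of the integrand together, this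
  produces the constant h / (d + k).\<close>

lemma nn_integral_power_ratio:
  fixes h :: real
  assumes "h > 0"
  shows "(\<integral>\<^sup>+s. ennreal ((s / h) ^ m) * indicator {0<..<h} s \<partial>lborel) = ennreal (h / (m + 1))"
proof -
  have "(\<integral>\<^sup>+s. ennreal ((s / h) ^ m) * indicator {0<..<h} s \<partial>lborel) =
      (\<integral>\<^sup>+s. ennreal ((s / h) ^ m) * indicator {0..h} s \<partial>lborel)"
  proof (rule nn_integral_cong_AE)
    \<comment> \<open>The fundamental theorem of calculus wants the closed interval, while a pyramid
      leaves out its apex and its base.\<close>
    have "AE s in lborel. s \<notin> {0, h}"
      by (intro AE_not_in finite_imp_null_set_lborel) auto
    then show "AE s in lborel. ennreal ((s / h) ^ m) * indicator {0<..<h} s =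
        ennreal ((s / h) ^ m) * indicator {0..h} s"
      by eventually_elim (auto simp: indicator_def)
  qed
  also have "\<dots> = ennreal (h / (m + 1) * (h / h) ^ (m + 1) - h / (m + 1) * (0 / h) ^ (m + 1))"
  proof (rule nn_integral_FTC_Icc[where F = "\<lambda>s. h / (m + 1) * (s / h) ^ (m + 1)"])
    fix s :: real
    have "((\<lambda>s. h / (m + 1) * (s / h) ^ (m + 1)) has_real_derivative
        h / (m + 1) * (real (m + 1) * (1 / h * (s / h) ^ m))) (at s)"
      using DERIV_power_Suc[OF DERIV_cdivide[OF DERIV_ident, of h], of m s UNIV]
      by (intro DERIV_cmult) simp
    moreover have "h / n * (n * (1 / h * y)) = y" if "n > 0" for n y :: real
      using that assms by simp
    from this[of "m + 1"] have "h / (m + 1) * (real (m + 1) * (1 / h * (s / h) ^ m)) = (s / h) ^ m"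
      by simp
    ultimately show "((\<lambda>s. h / (m + 1) * (s / h) ^ (m + 1)) has_real_derivative (s / h) ^ m) (at s)"
      by simp
  qed (use assms in auto)
  finally show ?thesis using assms by simp
qed

text \<open>The last condition says that the ray from the apex \<open>z\<close> through \<open>x\<close> meets the hyperplane at
  distance \<open>h\<close> in direction \<open>u\<close> in a point of the base \<open>F\<close>.\<close>
definition pyramid :: "'a::euclidean_space \<Rightarrow> 'a \<Rightarrow> real \<Rightarrow> 'a set \<Rightarrow> 'a set" where
  "pyramid z u h F = {x. 0 < u \<bullet> (x - z) \<and> u \<bullet> (x - z) < h \<and>
    z + (h / (u \<bullet> (x - z))) *\<^sub>R (x - z) \<in> F}"

lemma pyramid_measurable [measurable]:
  assumes [measurable]: "F \<in> sets borel"
  shows "pyramid z u h F \<in> sets borel"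
  unfolding pyramid_def by measurable

text \<open>Fubini along \<open>u\<close>: the layer at height s is the base shrunk towards
  \<open>z\<close> by the factor s / h, which scales areas by (s / h) ^ (d - 1), while homogeneity
  scales \<open>g\<close> by (s / h) ^ k.\<close>

lemma nn_integral_pyramid:
  fixes u z p :: "'a::euclidean_space"
  assumes C: "pairwise orthogonal (insert u B)" "\<And>b. b \<in> insert u B \<Longrightarrow> norm b = 1"
      "u \<notin> B" "card (insert u B) = DIM('a)"
    and h: "h > 0" "u \<bullet> (p - z) = h"
    and g [measurable]: "g \<in> borel_measurable borel"
    and hom: "\<And>t w. t > 0 \<Longrightarrow> g (z + t *\<^sub>R w) = ennreal (t ^ k) * g (z + w)"
    and F [measurable]: "F \<in> sets borel"
  shows "(\<integral>\<^sup>+x. g x * indicator (pyramid z u h F) x \<partial>lborel) =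
    ennreal (h / (DIM('a) + k)) * (\<integral>\<^sup>+x. g x * indicator F x \<partial>frame_lborel p B)"
proof -
  note fin = finite_orthonormal_basis[OF C(1,2,4)] and span = span_orthonormal_basis[OF C(1,2,4)]
  from fin have finB [simp]: "finite B" by simp
  have DIM: "DIM('a) = Suc (card B)" using C(3,4) finB by simp
  have uB: "u \<bullet> b = 0" if "b \<in> B" for b
    using C(1,3) that by (auto simp: pairwise_def orthogonal_def)
  have uu: "u \<bullet> u = 1" using C(2)[of u] by (simp add: norm_eq_1)
  define G where "G x = g x * indicator (pyramid z u h F) x" for x
  have [measurable]: "G \<in> borel_measurable borel" unfolding G_def by measurable
  define I where "I = (\<integral>\<^sup>+x. g x * indicator F x \<partial>frame_lborel p B)"
  have I: "I = (\<integral>\<^sup>+f. g (p + (\<Sum>b\<in>B. f b *\<^sub>R b)) * indicator F (p + (\<Sum>b\<in>B. f b *\<^sub>R b)) \<partial>(\<Pi>\<^sub>M b\<in>B. lborel))"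
    unfolding I_def frame_lborel_def by (subst nn_integral_distr) auto
  have inner: "(\<integral>\<^sup>+f. G (z + s *\<^sub>R u + (\<Sum>b\<in>B. f b *\<^sub>R b)) \<partial>(\<Pi>\<^sub>M b\<in>B. lborel)) =
      ennreal ((s / h) ^ (card B + k)) * indicator {0<..<h} s * I" for s
  proof (cases "0 < s \<and> s < h")
    case False
    \<comment> \<open>Every point of this layer has height \<open>s\<close>, so it misses the
      pyramid, which lies strictly between the heights 0 and \<open>h\<close>.\<close>
    have "u \<bullet> (s *\<^sub>R u + (\<Sum>b\<in>B. f b *\<^sub>R b)) = s" for f
      using uB by (simp add: inner_add_right inner_sum_right uu)
    then have "G (z + s *\<^sub>R u + (\<Sum>b\<in>B. f b *\<^sub>R b)) = 0" for f
      using False by (auto simp: G_def pyramid_def indicator_def add.assoc)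
    then show ?thesis using False by auto
  next
    case True
    define t where "t = s / h"
    have t: "t > 0" "s = t * h" using True h by (auto simp: t_def)
    \<comment> \<open>The origin \<open>p\<close> of the frame may differ from the foot of the
      perpendicular from \<open>z\<close>; its offset along \<open>B\<close> becomes the shift in
      the affine substitution below.\<close>
    have pz: "h *\<^sub>R u + (\<Sum>b\<in>B. ((p - z) \<bullet> b) *\<^sub>R b) = p - z"
      using orthonormal_basis_expand[OF C(1,2) span fin, of "p - z"] C(3) h(2)
      by (simp add: inner_commute)
    have arg: "z + s *\<^sub>R u + (\<Sum>b\<in>B. (t * ((p - z) \<bullet> b) + t * f b) *\<^sub>R b) =
        z + t *\<^sub>R (p - z + (\<Sum>b\<in>B. f b *\<^sub>R b))" for f
    proof -
      have "(\<Sum>b\<in>B. (t * ((p - z) \<bullet> b) + t * f b) *\<^sub>R b) =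
          t *\<^sub>R (\<Sum>b\<in>B. ((p - z) \<bullet> b) *\<^sub>R b) + t *\<^sub>R (\<Sum>b\<in>B. f b *\<^sub>R b)"
        by (simp add: scaleR_add_left sum.distrib scaleR_sum_right)
      then show ?thesis
        by (subst pz[symmetric]) (simp add: t(2) algebra_simps)
    qed
    have up: "u \<bullet> (p - z + (\<Sum>b\<in>B. f b *\<^sub>R b)) = h" for f
      using uB by (simp add: inner_add_right inner_sum_right h(2))
    have "G (z + t *\<^sub>R (p - z + (\<Sum>b\<in>B. f b *\<^sub>R b))) = ennreal (t ^ k) *
        (g (p + (\<Sum>b\<in>B. f b *\<^sub>R b)) * indicator F (p + (\<Sum>b\<in>B. f b *\<^sub>R b)))" for f
    proof -
      have "z + t *\<^sub>R (p - z + (\<Sum>b\<in>B. f b *\<^sub>R b)) \<in> pyramid z u h F \<longleftrightarrow> p + (\<Sum>b\<in>B. f b *\<^sub>R b) \<in> F"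
        using True t h(1) by (simp add: pyramid_def up del: scaleR_scaleR) simp
      then show ?thesis
        using hom[OF t(1), of "p - z + (\<Sum>b\<in>B. f b *\<^sub>R b)"]
        by (simp add: G_def indicator_def mult.assoc)
    qed
    then have "(\<integral>\<^sup>+f. G (z + s *\<^sub>R u + (\<Sum>b\<in>B. f b *\<^sub>R b)) \<partial>(\<Pi>\<^sub>M b\<in>B. lborel)) =
        ennreal (t ^ card B) * (ennreal (t ^ k) * I)"
      using nn_integral_PiM_lborel_affine[OF finB t(1),
          of "\<lambda>f. G (z + s *\<^sub>R u + (\<Sum>b\<in>B. f b *\<^sub>R b))" "\<lambda>b. t * ((p - z) \<bullet> b)"]
      by (simp add: arg I nn_integral_cmult)
    then show ?thesis
      using True t(1) by (simp add: t_def power_add ennreal_mult' mult.assoc)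
  qed
  interpret product_sigma_finite "\<lambda>_. lborel :: real measure" ..
  have upd: "(\<Sum>b\<in>insert u B. (v(u := s)) b *\<^sub>R b) = s *\<^sub>R u + (\<Sum>b\<in>B. v b *\<^sub>R b)" for v s
    using C(3) by (auto intro!: sum.cong)
  have "(\<integral>\<^sup>+x. G x \<partial>lborel) = (\<integral>\<^sup>+x. G (z + x) \<partial>lborel)"
    by (rule nn_integral_lborel_translation) measurable
  also have "\<dots> = (\<integral>\<^sup>+v. G (z + (\<Sum>b\<in>insert u B. v b *\<^sub>R b)) \<partial>(\<Pi>\<^sub>M b\<in>insert u B. lborel))"
    using C by (intro nn_integral_lborel_frame) auto
  also have "\<dots> = (\<integral>\<^sup>+s. (\<integral>\<^sup>+v. G (z + (\<Sum>b\<in>insert u B. (v(u := s)) b *\<^sub>R b)) \<partial>(\<Pi>\<^sub>M b\<in>B. lborel)) \<partial>lborel)"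
    using C(3) by (intro product_nn_integral_insert_rev) auto
  also have "\<dots> = (\<integral>\<^sup>+s. ennreal ((s / h) ^ (card B + k)) * indicator {0<..<h} s * I \<partial>lborel)"
    unfolding upd by (simp only: inner flip: add.assoc)
  also have "\<dots> = ennreal (h / (card B + k + 1)) * I"
    using nn_integral_power_ratio[OF h(1), of "card B + k"] by (subst nn_integral_multc) auto
  finally show ?thesis
    by (simp add: G_def I_def DIM add_ac)
qed

section \<open>Integration against the surface measure\<close>

text \<open>Only the measure of sets is known so far. Both sides respect scaling, sums and
  increasing limits in \<open>g\<close>, so agreement on indicators is enough.\<close>

lemma nn_integral_surface_measure:
  fixes K :: "'a::euclidean_space set"
  assumes K: "polytope K" and g: "g \<in> borel_measurable borel"
  shows "(\<integral>\<^sup>+x. g x \<partial>surface_measure K) =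
    (\<Sum>F | F facet_of K. \<integral>\<^sup>+x. g x * indicator F x \<partial>affine_lborel (affine hull F))"
proof -
  have S [measurable_cong]: "sets (affine_lborel (affine hull F)) = sets borel"
    and F [measurable]: "F \<in> sets borel" if "F facet_of K" for F
  proof -
    show "sets (affine_lborel (affine hull F)) = sets borel"
      using that by (intro sets_affine_lborel) (auto simp: facet_of_def)
    have "closed F"
      using K that face_of_polytope_polytope facet_of_imp_face_of polytope_imp_closed by blast
    then show "F \<in> sets borel" by auto
  qed
  have meas: "f \<in> borel_measurable (affine_lborel (affine hull F))"
    if "F facet_of K" "f \<in> borel_measurable borel" for F and f :: "'a \<Rightarrow> ennreal"
    using that measurable_cong_sets[OF S[OF that(1)] refl] by auto
  from g show ?thesis
  proof (induction g rule: borel_measurable_induct)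
    case (cong f g)
    then have "f = g" by auto
    with cong show ?case by simp
  next
    case (set A)
    have "(\<integral>\<^sup>+x. indicator A x * indicator F x \<partial>affine_lborel (affine hull F)) =
        emeasure (affine_lborel (affine hull F)) (A \<inter> F)" if "F facet_of K" for F
    proof -
      have "A \<inter> F \<in> sets (affine_lborel (affine hull F))"
        using set F[OF that] S[OF that] by auto
      then show ?thesis by (simp flip: indicator_inter_arith)
    qed
    then show ?case using set by (simp add: emeasure_surface_measure[OF K])
  next
    case (mult u c)
    have "(\<integral>\<^sup>+x. c * u x * indicator F x \<partial>affine_lborel (affine hull F)) =
        c * (\<integral>\<^sup>+x. u x * indicator F x \<partial>affine_lborel (affine hull F))" if "F facet_of K" for F
      unfolding mult.assoc using mult(2) F[OF that]
      by (intro nn_integral_cmult meas[OF that]) simp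
    then show ?case using mult by (simp add: nn_integral_cmult sum_distrib_left)
  next
    case (add u v)
    have "(\<integral>\<^sup>+x. (v x + u x) * indicator F x \<partial>affine_lborel (affine hull F)) =
        (\<integral>\<^sup>+x. v x * indicator F x \<partial>affine_lborel (affine hull F)) +
        (\<integral>\<^sup>+x. u x * indicator F x \<partial>affine_lborel (affine hull F))" if "F facet_of K" for F
      unfolding distrib_right using add F[OF that]
      by (intro nn_integral_add meas[OF that]) simp_all
    then show ?case using add by (simp add: nn_integral_add sum.distrib)
  next
    case (seq U)
    have inc: "incseq (\<lambda>i x. U i x * indicator F x)" for F
      using seq(3) by (auto simp: incseq_def le_fun_def intro!: mult_right_mono)
    have "(\<integral>\<^sup>+x. (SUP i. U i x) * indicator F x \<partial>affine_lborel (affine hull F)) =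
        (SUP i. \<integral>\<^sup>+x. U i x * indicator F x \<partial>affine_lborel (affine hull F))" if "F facet_of K" for F
    proof -
      have "(\<integral>\<^sup>+x. (SUP i. U i x) * indicator F x \<partial>affine_lborel (affine hull F)) =
          (\<integral>\<^sup>+x. (SUP i. U i x * indicator F x) \<partial>affine_lborel (affine hull F))"
        by (simp add: SUP_mult_right_ennreal)
      also have "\<dots> = (SUP i. \<integral>\<^sup>+x. U i x * indicator F x \<partial>affine_lborel (affine hull F))"
        using seq(1) F[OF that] inc
        by (intro nn_integral_monotone_convergence_SUP meas[OF that]) simp_all
      finally show ?thesis .
    qed
    \<comment> \<open>Monotonicity lets the supremum pass through the sum over the facets.\<close>
    moreover have "incseq (\<lambda>i. \<integral>\<^sup>+x. U i x * indicator F x \<partial>affine_lborel (affine hull F))" for F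
      using inc by (auto simp: incseq_def le_fun_def intro!: nn_integral_mono)
    moreover have "(\<integral>\<^sup>+x. (SUP i. U i x) \<partial>surface_measure K) = (SUP i. \<integral>\<^sup>+x. U i x \<partial>surface_measure K)"
      using seq by (intro nn_integral_monotone_convergence_SUP) auto
    ultimately show ?case
      using seq(4,5) by (simp add: ennreal_SUP_sum image_comp)
  qed
qed

section \<open>Reflection and vanishing means\<close>

lemma nn_integral_uniform_reflection:
  fixes K :: "'a::euclidean_space set"
  assumes [measurable]: "K \<in> sets borel" "f \<in> borel_measurable borel" and sym: "centrally_symmetric K c"
  shows "(\<integral>\<^sup>+x. f (2 *\<^sub>R c - x) \<partial>uniform_measure lborel K) = (\<integral>\<^sup>+x. f x \<partial>uniform_measure lborel K)"
proof -
  have "2 *\<^sub>R c - x \<in> K \<longleftrightarrow> x \<in> K" for x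
  proof -
    have "2 *\<^sub>R c - y \<in> K" if "y \<in> K" for y
      using sym that unfolding centrally_symmetric_def by blast
    from this[of x] this[of "2 *\<^sub>R c - x"] show ?thesis by auto
  qed
  then have K: "(indicator K (2 *\<^sub>R c - x) :: ennreal) = indicator K x" for x
    by (simp add: indicator_def)
  have "(\<integral>\<^sup>+x. f x * indicator K x \<partial>lborel) = (\<integral>\<^sup>+x. f (2 *\<^sub>R c - x) * indicator K (2 *\<^sub>R c - x) \<partial>lborel)"
    by (subst lborel_affine[of "-1" "2 *\<^sub>R c"]) (auto simp: nn_integral_density nn_integral_distr)
  then show ?thesis
    by (simp add: nn_integral_uniform_measure K)
qed

text \<open>For integrable \<open>f\<close> the positive and negative parts cancel; otherwise the
  Bochner integral is 0 by convention. Thus the means need no integrability proof.\<close>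

lemma integral_eq_0_of_nn_integral_eq:
  fixes f :: "'a \<Rightarrow> real"
  assumes "(\<integral>\<^sup>+x. ennreal (f x) \<partial>M) = (\<integral>\<^sup>+x. ennreal (- f x) \<partial>M)"
  shows "(\<integral>x. f x \<partial>M) = 0"
  using assms by (cases "integrable M f") (auto simp: real_lebesgue_integral_def not_integrable_integral_eq)

section \<open>Facets of a polytope with an inscribed ball\<close>

text \<open>Holds the witnesses of \<open>circumscribed K\<close>. The formula relating body and
  boundary lives at this generality; symmetry enters only for the means and to identify
  \<open>z\<close> with the centre of symmetry.\<close>

locale inscribed_ball =
  fixes K :: "'a::euclidean_space set" and z :: 'a and r :: real
  assumes polytope: "polytope K" and r_pos: "r > 0" and ball_subset: "cball z r \<subseteq> K"
    and tangent: "\<And>F. F facet_of K \<Longrightarrow> tangent_hyperplane (affine hull F) z r"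
begin

lemma convex: "convex K" and compact: "compact K"
  using polytope polytope_imp_convex polytope_imp_compact by auto

lemma borel_K [measurable]: "K \<in> sets borel"
  using compact by (auto intro: borel_compact)

lemma center_interior: "z \<in> interior K"
  using ball_subset r_pos by (meson ball_subset_cball centre_in_ball interior_maximal open_ball order_trans subsetD)

lemma frontier_eq: "frontier K = \<Union> {F. F facet_of K}"
  using rel_frontier_of_polyhedron[OF polytope_imp_polyhedron[OF polytope]] center_interior
  by (metis empty_iff rel_frontier_nonempty_interior)

lemma finite_facets: "finite {F. F facet_of K}"
  using finite_polyhedron_facets polytope_imp_polyhedron[OF polytope] by blast

lemma facet_borel: "F facet_of K \<Longrightarrow> F \<in> sets borel"
  using polytope face_of_polytope_polytope facet_of_imp_face_of polytope_imp_closed borel_closed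
  by blast

lemma facet_subset: "F facet_of K \<Longrightarrow> F \<subseteq> K"
  using facet_of_imp_subset by auto

lemma facet_eq: "F facet_of K \<Longrightarrow> F = affine hull F \<inter> K"
  using face_of_imp_eq_affine_Int[OF convex] facet_of_imp_face_of by blast

text \<open>\<open>u\<close> is the outer unit normal of the facet; measuring from \<open>z\<close>
  turns tangency into one common offset \<open>r\<close> for all facets.\<close>

definition is_normal :: "'a set \<Rightarrow> 'a \<Rightarrow> bool" where
  "is_normal F u \<longleftrightarrow> norm u = 1 \<and> affine hull F = {x. u \<bullet> (x - z) = r} \<and> (\<forall>x\<in>K. u \<bullet> (x - z) \<le> r)"

text \<open>The distance from \<open>z\<close> to the hyperplane is squeezed to \<open>r\<close>:
  from above because the closed ball is met, from below because the open ball is missed. No point of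
  \<open>K\<close> lies beyond the hyperplane, since the segment from \<open>z\<close> to it would
  cross \<open>F\<close> in an inner point, and a face containing such a point contains
  \<open>z\<close>.\<close>

lemma normal_exists:
  assumes F: "F facet_of K"
  shows "\<exists>u. is_normal F u"
proof -
  have "aff_dim K = DIM('a)"
    using center_interior aff_dim_nonempty_interior by blast
  then have "aff_dim F = DIM('a) - 1"
    using F by (simp add: facet_of_def)
  then obtain a b where a: "a \<noteq> 0" and H: "affine hull F = {x. a \<bullet> x = b}"
    using aff_dim_eq_hyperplane by blast
  have T: "affine hull F \<inter> cball z r \<noteq> {}" "affine hull F \<inter> ball z r = {}"
    using tangent[OF F] by (auto simp: tangent_hyperplane_def)
  then have az: "a \<bullet> z \<noteq> b"
    using r_pos by (auto simp: H disjoint_iff)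
  \<comment> \<open>The sign turns \<open>a\<close> from \<open>z\<close> towards the hyperplane,
    which makes the offset \<open>\<beta>\<close> positive.\<close>
  define \<sigma> where "\<sigma> = sgn (b - a \<bullet> z)"
  define u where "u = (\<sigma> / norm a) *\<^sub>R a"
  define \<beta> where "\<beta> = \<bar>b - a \<bullet> z\<bar> / norm a"
  have \<sigma>: "\<bar>\<sigma>\<bar> = 1" "\<bar>b - a \<bullet> z\<bar> = \<sigma> * (b - a \<bullet> z)"
    using az by (auto simp: \<sigma>_def sgn_if)
  have u: "norm u = 1" using a \<sigma> by (simp add: u_def)
  have H': "affine hull F = {x. u \<bullet> (x - z) = \<beta>}"
  proof -
    have "u \<bullet> (x - z) = \<beta> \<longleftrightarrow> a \<bullet> x = b" for x
    proof -
      have "u \<bullet> (x - z) = \<beta> \<longleftrightarrow> \<sigma> * (a \<bullet> (x - z)) = \<sigma> * (b - a \<bullet> z)"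
        using a by (simp add: u_def \<beta>_def \<sigma>(2))
      also have "\<dots> \<longleftrightarrow> a \<bullet> x = b"
        using \<sigma>(1) by (auto simp: inner_diff_right)
      finally show ?thesis .
    qed
    then show ?thesis using H by auto
  qed
  have \<beta>_pos: "\<beta> > 0" using az a by (simp add: \<beta>_def)
  have uu: "u \<bullet> u = 1" using u by (simp add: norm_eq_1)
  have \<beta>: "\<beta> = r"
  proof (rule antisym)
    obtain y where "y \<in> affine hull F" "y \<in> cball z r" using T(1) by auto
    then have "u \<bullet> (y - z) = \<beta>" "norm (y - z) \<le> r"
      using H' by (auto simp: dist_norm norm_minus_commute)
    then show "\<beta> \<le> r"
      using norm_cauchy_schwarz[of u "y - z"] u by simp
    \<comment> \<open>The point of the hyperplane nearest to \<open>z\<close>.\<close>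
    have "z + \<beta> *\<^sub>R u \<in> affine hull F" by (simp add: H' uu)
    then have "z + \<beta> *\<^sub>R u \<notin> ball z r" using T(2) by auto
    then show "r \<le> \<beta>" using \<beta>_pos u by (simp add: dist_norm)
  qed
  have "u \<bullet> (y - z) \<le> r" if y: "y \<in> K" for y
  proof (rule ccontr)
    assume "\<not> ?thesis"
    then have gt: "r < u \<bullet> (y - z)" by simp
    \<comment> \<open>The parameter at which the segment from \<open>z\<close> to \<open>y\<close>
      crosses the hyperplane.\<close>
    define t where "t = r / (u \<bullet> (y - z))"
    have t: "0 < t" "t < 1" using gt r_pos by (auto simp: t_def)
    define w where "w = z + t *\<^sub>R (y - z)"
    have w_eq: "w = (1 - t) *\<^sub>R z + t *\<^sub>R y" by (simp add: w_def algebra_simps)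
    have zy: "z \<noteq> y" using gt r_pos by auto
    have zK: "z \<in> K" using center_interior interior_subset by blast
    have seg: "w \<in> open_segment z y"
      using t zy w_eq by (auto simp: in_segment)
    have "w \<in> K" using convexD_alt[OF convex zK y, of t] t w_eq by simp
    moreover have "w \<in> affine hull F"
      using gt r_pos by (simp add: H' \<beta> w_def t_def)
    ultimately have "w \<in> F" using facet_eq[OF F] by auto
    then have "z \<in> F"
      using seg y zK facet_of_imp_face_of[OF F] by (auto simp: face_of_def)
    then have "z \<in> affine hull F" by (simp add: hull_inc)
    then show False using r_pos by (simp add: H' \<beta>)
  qed
  then show ?thesis using u H' \<beta> by (auto simp: is_normal_def)
qed

definition normal :: "'a set \<Rightarrow> 'a" where "normal F = (SOME u. is_normal F u)"

lemma
  assumes "F facet_of K"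
  shows norm_normal: "norm (normal F) = 1"
    and hull_facet: "affine hull F = {x. normal F \<bullet> (x - z) = r}"
    and normal_le: "x \<in> K \<Longrightarrow> normal F \<bullet> (x - z) \<le> r"
  using someI_ex[OF normal_exists[OF assms]] by (auto simp: is_normal_def normal_def)

lemma normal_facet: "F facet_of K \<Longrightarrow> x \<in> F \<Longrightarrow> normal F \<bullet> (x - z) = r"
  using hull_facet hull_inc[of x F affine] by blast

text \<open>All facet hyperplanes have the same offset from \<open>z\<close>, so the normal
  determines the hyperplane and with it the facet.\<close>

lemma normal_inj: "F facet_of K \<Longrightarrow> F' facet_of K \<Longrightarrow> normal F = normal F' \<Longrightarrow> F = F'"
  using facet_eq hull_facet by metis

section \<open>Decomposition into pyramids\<close>

abbreviation facet_pyramid :: "'a set \<Rightarrow> 'a set" where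
  "facet_pyramid F \<equiv> pyramid z (normal F) r F"

text \<open>Whatever frame \<open>affine_lborel\<close> has picked, its vectors span the orthogonal
  complement of the normal, so together with the normal they form an orthonormal basis of the whole
  space.\<close>

lemma nn_integral_facet_pyramid:
  assumes F: "F facet_of K" and g: "g \<in> borel_measurable borel"
    and hom: "\<And>t w. t > 0 \<Longrightarrow> g (z + t *\<^sub>R w) = ennreal (t ^ k) * g (z + w)"
  shows "(\<integral>\<^sup>+x. g x * indicator (facet_pyramid F) x \<partial>lborel) =
    ennreal (r / (DIM('a) + k)) * (\<integral>\<^sup>+x. g x * indicator F x \<partial>affine_lborel (affine hull F))"
proof -
  let ?u = "normal F"
  have uu: "?u \<bullet> ?u = 1" using norm_normal[OF F] by (simp add: norm_eq_1)
  obtain p B where fr: "orthonormal_frame (affine hull F) p B"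
    and eq: "affine_lborel (affine hull F) = frame_lborel p B"
    using affine_lborel_frame[of "affine hull F"] F by (auto simp: facet_of_def)
  from fr have B: "pairwise orthogonal B" "\<And>b. b \<in> B \<Longrightarrow> norm b = 1"
    and H: "affine hull F = (\<lambda>v. p + v) ` span B"
    by (auto simp: orthonormal_frame_def)
  have mem: "p + v \<in> affine hull F \<longleftrightarrow> v \<in> span B" for v
    unfolding H by auto
  have p: "?u \<bullet> (p - z) = r"
    using mem[of 0] hull_facet[OF F] span_zero by auto
  have span: "span B = {v. ?u \<bullet> v = 0}"
  proof (intro set_eqI)
    fix v
    show "v \<in> span B \<longleftrightarrow> v \<in> {v. ?u \<bullet> v = 0}"
      using mem[of v] p by (auto simp: hull_facet[OF F] inner_diff_right inner_add_right)
  qed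
  have "?u \<noteq> 0" using uu by auto
  then have dim: "dim (span B) = DIM('a) - 1"
    unfolding span by (rule dim_hyperplane)
  have "0 \<notin> B" using B(2) by force
  then have ind: "independent B" using B(1) pairwise_orthogonal_independent by blast
  then have card: "card B = DIM('a) - 1" using dim by (simp add: dim_eq_card_independent)
  have uB: "?u \<bullet> b = 0" if "b \<in> B" for b
    using span span_base[OF that] by auto
  have notin: "?u \<notin> B" using uB uu by force
  show ?thesis
    unfolding eq
  proof (rule nn_integral_pyramid)
    show "pairwise orthogonal (insert ?u B)"
      using B(1) uB by (auto simp: pairwise_insert orthogonal_def inner_commute)
    show "card (insert ?u B) = DIM('a)"
      using notin ind card independent_imp_finite[OF ind] by simp
  qed (use B norm_normal[OF F] notin r_pos p g hom facet_borel[OF F] in auto)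
qed

lemma facet_pyramid_subset:
  assumes F: "F facet_of K"
  shows "facet_pyramid F \<subseteq> K"
proof
  fix x assume x: "x \<in> facet_pyramid F"
  define s where "s = normal F \<bullet> (x - z)"
  define y where "y = z + (r / s) *\<^sub>R (x - z)"
  have s: "0 < s" "s < r" and "y \<in> F"
    using x by (auto simp: pyramid_def s_def y_def)
  then have "y \<in> K" using facet_subset[OF F] by auto
  moreover have "z \<in> K" using center_interior interior_subset by blast
  ultimately have "(1 - s / r) *\<^sub>R z + (s / r) *\<^sub>R y \<in> K"
    using s r_pos by (intro convexD_alt[OF convex]) auto
  moreover have "(1 - s / r) *\<^sub>R z + (s / r) *\<^sub>R y = x"
    using s r_pos by (simp add: y_def algebra_simps)
  ultimately show "x \<in> K" by simp
qed

text \<open>The ray from \<open>z\<close> through \<open>x\<close> leaves \<open>K\<close> in a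
  point of some facet, strictly beyond \<open>x\<close>.\<close>

lemma interior_in_facet_pyramid:
  assumes x: "x \<in> interior K" "x \<noteq> z"
  obtains F where "F facet_of K" "x \<in> facet_pyramid F"
proof -
  obtain d where d: "d > 0" "z + d *\<^sub>R (x - z) \<in> frontier K"
    using ray_to_frontier[of K z "x - z"] compact_imp_bounded[OF compact] center_interior x(2)
    by auto
  \<comment> \<open>Otherwise the exit point would be a convex combination of two interior
    points.\<close>
  have "d > 1"
  proof (rule ccontr)
    assume "\<not> d > 1"
    then have "(1 - d) *\<^sub>R z + d *\<^sub>R x \<in> interior K"
      using d(1) center_interior x(1) by (intro convexD_alt convex_interior convex) auto
    moreover have "(1 - d) *\<^sub>R z + d *\<^sub>R x = z + d *\<^sub>R (x - z)" by (simp add: algebra_simps)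
    ultimately show False using d(2) by (simp add: frontier_def)
  qed
  obtain F where F: "F facet_of K" "z + d *\<^sub>R (x - z) \<in> F"
    using d(2) frontier_eq by auto
  have "d * (normal F \<bullet> (x - z)) = r" using normal_facet[OF F] by simp
  then have n: "normal F \<bullet> (x - z) = r / d" using d(1) by (simp add: field_simps)
  have "x \<in> facet_pyramid F"
    using n \<open>d > 1\<close> r_pos F(2) by (simp add: pyramid_def divide_less_eq)
  then show ?thesis using F(1) that by blast
qed

text \<open>Projecting \<open>x\<close> from \<open>z\<close> onto the base gives a point of
  \<open>K\<close>, where the functional of \<open>F\<close> equals \<open>r\<close> and that of
  \<open>F'\<close> is at most \<open>r\<close>; scaling back keeps the inequality. Hence two
  pyramids overlap only where their functionals tie.\<close>

lemma facet_pyramid_Int_le: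
  assumes "F facet_of K" "F' facet_of K" "x \<in> facet_pyramid F"
  shows "normal F' \<bullet> (x - z) \<le> normal F \<bullet> (x - z)"
proof -
  define s where "s = normal F \<bullet> (x - z)"
  have s: "0 < s" and y: "z + (r / s) *\<^sub>R (x - z) \<in> F"
    using assms(3) by (auto simp: pyramid_def s_def)
  have "normal F' \<bullet> (z + (r / s) *\<^sub>R (x - z) - z) \<le> r"
    using y facet_subset[OF assms(1)] by (intro normal_le[OF assms(2)]) auto
  then have "(r / s) * (normal F' \<bullet> (x - z)) \<le> r" by simp
  then show ?thesis using s r_pos by (simp add: s_def[symmetric] field_simps)
qed

text \<open>The exceptional set consists of the frontier, the apex and, for each pair of facets, the
  hyperplane through \<open>z\<close> where their functionals tie. Off it, every point of
  \<open>K\<close> lies in exactly one pyramid.\<close>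

lemma AE_facet_pyramids:
  "AE x in lborel. (indicator K x :: ennreal) = (\<Sum>F | F facet_of K. indicator (facet_pyramid F) x)"
proof -
  have null: "AE x in lborel. x \<notin> N" if "negligible N" "N \<in> sets borel" for N :: "'a set"
    using that negligible_iff_null_sets null_sets_completion_iff[of N lborel]
    by (intro AE_not_in) auto
  have "AE x in lborel. x \<notin> frontier K"
    using negligible_convex_frontier[OF convex] by (intro null) auto
  moreover have "AE x in lborel. x \<notin> {z}"
    by (intro null) auto
  moreover have "AE x in lborel. \<forall>F\<in>{F. F facet_of K}. \<forall>F'\<in>{F. F facet_of K}. F \<noteq> F' \<longrightarrow>
      normal F \<bullet> (x - z) \<noteq> normal F' \<bullet> (x - z)"
  proof (intro AE_finite_allI finite_facets)
    fix F F' assume F: "F \<in> {F. F facet_of K}" "F' \<in> {F. F facet_of K}"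
    show "AE x in lborel. F \<noteq> F' \<longrightarrow> normal F \<bullet> (x - z) \<noteq> normal F' \<bullet> (x - z)"
    proof (cases "F = F'")
      case False
      then have "normal F - normal F' \<noteq> 0" using normal_inj F by auto
      then have "AE x in lborel. x \<notin> {x. (normal F - normal F') \<bullet> x = (normal F - normal F') \<bullet> z}"
        by (intro null negligible_hyperplane borel_closed closed_hyperplane) auto
      then show ?thesis
        by eventually_elim (auto simp: inner_diff_left inner_diff_right)
    qed simp
  qed
  ultimately show ?thesis
  proof eventually_elim
    case (elim x)
    show ?case
    proof (cases "x \<in> K")
      case False
      then have "x \<notin> facet_pyramid F" if "F facet_of K" for F
        using facet_pyramid_subset[OF that] by auto
      then show ?thesis using False by simp
    next
      case True
      then have "x \<in> interior K"
        using elim(1) compact by (auto simp: frontier_def compact_imp_closed)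
      then obtain F where F: "F facet_of K" "x \<in> facet_pyramid F"
        using interior_in_facet_pyramid elim(2) by auto
      have "x \<notin> facet_pyramid F'" if "F' facet_of K" "F' \<noteq> F" for F'
        using facet_pyramid_Int_le[OF F(1) that(1) F(2)] facet_pyramid_Int_le[OF that(1) F(1)]
          elim(3) F(1) that by force
      then have "(\<Sum>F | F facet_of K. indicator (facet_pyramid F) x) =
          (\<Sum>F'\<in>{F}. indicator (facet_pyramid F') x :: ennreal)"
        using F(1) finite_facets by (intro sum.mono_neutral_right) auto
      then show ?thesis using F(2) True by simp
    qed
  qed
qed

section \<open>From the body to its boundary\<close>

lemma nn_integral_homogeneous:
  assumes g [measurable]: "g \<in> borel_measurable borel"
    and hom: "\<And>t w. t > 0 \<Longrightarrow> g (z + t *\<^sub>R w) = ennreal (t ^ k) * g (z + w)"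
  shows "(\<integral>\<^sup>+x. g x * indicator K x \<partial>lborel) =
    ennreal (r / (DIM('a) + k)) * (\<integral>\<^sup>+x. g x * indicator (frontier K) x \<partial>surface_measure K)"
proof -
  have [measurable]: "facet_pyramid F \<in> sets borel" if "F facet_of K" for F
    using facet_borel[OF that] by measurable
  have [measurable]: "frontier K \<in> sets borel" by auto
  have "(\<integral>\<^sup>+x. g x * indicator K x \<partial>lborel) =
      (\<integral>\<^sup>+x. (\<Sum>F | F facet_of K. g x * indicator (facet_pyramid F) x) \<partial>lborel)"
    using AE_facet_pyramids
    by (intro nn_integral_cong_AE) (auto simp: sum_distrib_left)
  also have "\<dots> = (\<Sum>F | F facet_of K. \<integral>\<^sup>+x. g x * indicator (facet_pyramid F) x \<partial>lborel)"
    by (intro nn_integral_sum) auto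
  also have "\<dots> = ennreal (r / (DIM('a) + k)) *
      (\<Sum>F | F facet_of K. \<integral>\<^sup>+x. g x * indicator F x \<partial>affine_lborel (affine hull F))"
    using nn_integral_facet_pyramid[OF _ g hom] by (simp add: sum_distrib_left)
  also have "(\<Sum>F | F facet_of K. \<integral>\<^sup>+x. g x * indicator F x \<partial>affine_lborel (affine hull F)) =
      (\<integral>\<^sup>+x. g x * indicator (frontier K) x \<partial>surface_measure K)"
  proof -
    \<comment> \<open>The frontier contains every facet, so its indicator, present to match
      \<open>uniform_measure\<close>, is 1 there.\<close>
    have "g x * indicator (frontier K) x * indicator F x = g x * indicator F x" if "F facet_of K" for F x
      using that by (auto simp: frontier_eq indicator_def)
    then show ?thesis
      by (subst nn_integral_surface_measure[OF polytope]) (auto intro!: sum.cong)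
  qed
  finally show ?thesis .
qed

text \<open>\<open>circumscribed\<close> leaves the position of the ball open. The facet to look at
  is the one hit by the ray from \<open>z\<close> through \<open>c\<close>: its normal has a
  positive component along \<open>c - z\<close>.\<close>

lemma center_of_symmetry:
  assumes "centrally_symmetric K c"
  shows "c = z"
proof (rule ccontr)
  assume "c \<noteq> z"
  then obtain d where d: "d > 0" "z + d *\<^sub>R (c - z) \<in> frontier K"
    using ray_to_frontier[of K z "c - z"] compact_imp_bounded[OF compact] center_interior by auto
  then obtain F where F: "F facet_of K" "z + d *\<^sub>R (c - z) \<in> F"
    using frontier_eq by auto
  let ?u = "normal F"
  have uu: "?u \<bullet> ?u = 1" using norm_normal[OF F(1)] by (simp add: norm_eq_1)
  have "d * (?u \<bullet> (c - z)) = r" using normal_facet[OF F] by simp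
  then have pos: "?u \<bullet> (c - z) > 0" using d(1) r_pos by (metis zero_less_mult_pos)
  text \<open>The reflected ball \<open>cball (2 *\<^sub>R c - z) r\<close> also lies in \<open>K\<close>, but protrudes beyond \<open>F\<close>.\<close>
  have "z - r *\<^sub>R ?u \<in> K"
    using ball_subset norm_normal[OF F(1)] r_pos by (auto simp: dist_norm)
  then have "2 *\<^sub>R c - (z - r *\<^sub>R ?u) \<in> K"
    using assms unfolding centrally_symmetric_def by blast
  then have "?u \<bullet> (2 *\<^sub>R c - (z - r *\<^sub>R ?u) - z) \<le> r"
    by (rule normal_le[OF F(1)])
  moreover have "2 *\<^sub>R c - (z - r *\<^sub>R ?u) - z = 2 *\<^sub>R (c - z) + r *\<^sub>R ?u"
    by (simp add: algebra_simps scaleR_2)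
  ultimately show False using pos uu by (simp add: inner_add_right)
qed

lemma emeasure_lborel_K: "emeasure lborel K \<noteq> 0" "emeasure lborel K \<noteq> \<infinity>"
proof -
  show "emeasure lborel K \<noteq> \<infinity>"
    using emeasure_compact_finite[OF compact] by simp
  have "0 < emeasure lborel (ball z r)"
    using r_pos by (simp add: emeasure_ball unit_ball_vol_pos)
  also have "\<dots> \<le> emeasure lborel K"
    using ball_subset by (intro emeasure_mono) (auto simp: subset_iff)
  finally show "emeasure lborel K \<noteq> 0" by simp
qed

text \<open>Dividing by the case k = 0, which says that the volume is r / d times the area, removes
  \<open>r\<close>.\<close>

lemma nn_integral_uniform_homogeneous:
  assumes g [measurable]: "g \<in> borel_measurable borel"
    and hom: "\<And>t w. t > 0 \<Longrightarrow> g (z + t *\<^sub>R w) = ennreal (t ^ k) * g (z + w)"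
  shows "(\<integral>\<^sup>+x. g x \<partial>uniform_measure lborel K) = ennreal (DIM('a) / (DIM('a) + k)) *
    (\<integral>\<^sup>+x. g x \<partial>uniform_measure (surface_measure K) (frontier K))"
proof -
  let ?S = "emeasure (surface_measure K) (frontier K)"
  let ?I = "\<integral>\<^sup>+x. g x * indicator (frontier K) x \<partial>surface_measure K"
  have [measurable]: "frontier K \<in> sets borel" by auto
  have vol: "emeasure lborel K = ennreal (r / DIM('a)) * ?S"
    using nn_integral_homogeneous[of "\<lambda>_. 1" 0] by simp
  \<comment> \<open>Positivity and finiteness of the area are inherited from the volume.\<close>
  have "?S \<noteq> 0" using vol emeasure_lborel_K(1) by auto
  moreover have "?S \<noteq> \<infinity>"
    using vol emeasure_lborel_K(2) r_pos by (auto simp: ennreal_mult_top)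
  ultimately obtain s where s: "?S = ennreal s" "s > 0"
    by (cases ?S) (auto simp: less_le)
  have "(\<integral>\<^sup>+x. g x \<partial>uniform_measure lborel K) = ennreal (r / (DIM('a) + k)) * ?I / ennreal (r / DIM('a) * s)"
    using r_pos s
    by (subst nn_integral_uniform_measure) (auto simp: nn_integral_homogeneous[OF g hom] vol simp flip: ennreal_mult)
  also have "\<dots> = ennreal (DIM('a) / (DIM('a) + k)) * (?I / ?S)"
  proof -
    have "r / (DIM('a) + k) / (r / DIM('a) * s) = DIM('a) / (DIM('a) + k) / s"
      using r_pos by simp
    moreover have "ennreal a * ?I / ennreal b = ennreal (a / b) * ?I" if "a \<ge> 0" "b > 0" for a b
      using that
      by (simp add: divide_ennreal_def inverse_ennreal ennreal_mult[symmetric] divide_inverse mult_ac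
          flip: mult.assoc)
    ultimately show ?thesis
      using r_pos s by (simp add: ennreal_times_divide)
  qed
  also have "?I / ?S = (\<integral>\<^sup>+x. g x \<partial>uniform_measure (surface_measure K) (frontier K))"
    by (subst nn_integral_uniform_measure) auto
  finally show ?thesis .
qed

lemma second_moment_uniform:
  "(\<integral>x. (norm (x - z))\<^sup>2 \<partial>uniform_measure lborel K) = DIM('a) / (DIM('a) + 2) *
    (\<integral>x. (norm (x - z))\<^sup>2 \<partial>uniform_measure (surface_measure K) (frontier K))"
  using nn_integral_uniform_homogeneous[of "\<lambda>x. ennreal ((norm (x - z))\<^sup>2)" 2]
  by (simp add: integral_eq_nn_integral power_mult_distrib ennreal_mult enn2real_mult)

text \<open>Reflection settles the body. For the boundary, \<open>ennreal\<close> cuts off negative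
  values, so the forms given by \<open>v\<close> and \<open>-v\<close> become homogeneous of degree
  1; both pass to the boundary with the same factor d / (d + 1), which cancels.\<close>

lemma first_moment_uniform_eq_0:
  assumes sym: "centrally_symmetric K z"
  shows "(\<integral>x. (x - z) \<bullet> v \<partial>uniform_measure lborel K) = 0"
    and "(\<integral>x. (x - z) \<bullet> v \<partial>uniform_measure (surface_measure K) (frontier K)) = 0"
proof -
  let ?U = "uniform_measure lborel K" and ?V = "uniform_measure (surface_measure K) (frontier K)"
  have U: "(\<integral>\<^sup>+x. ennreal ((x - z) \<bullet> v) \<partial>?U) = (\<integral>\<^sup>+x. ennreal (- ((x - z) \<bullet> v)) \<partial>?U)"
  proof -
    have "(2 *\<^sub>R z - x - z) \<bullet> v = - ((x - z) \<bullet> v)" for x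
      by (simp add: inner_diff_left scaleR_2 inner_add_left)
    then show ?thesis
      using nn_integral_uniform_reflection[OF _ _ sym, of "\<lambda>x. ennreal ((x - z) \<bullet> v)"] by simp
  qed
  then show "(\<integral>x. (x - z) \<bullet> v \<partial>?U) = 0"
    by (rule integral_eq_0_of_nn_integral_eq)
  have "(\<integral>\<^sup>+x. ennreal ((x - z) \<bullet> w) \<partial>?U) = ennreal (DIM('a) / (DIM('a) + 1)) * (\<integral>\<^sup>+x. ennreal ((x - z) \<bullet> w) \<partial>?V)" for w
    using nn_integral_uniform_homogeneous[of "\<lambda>x. ennreal ((x - z) \<bullet> w)" 1]
    by (simp add: ennreal_mult')
  from this[of v] this[of "-v"] U
  have "(\<integral>\<^sup>+x. ennreal ((x - z) \<bullet> v) \<partial>?V) = (\<integral>\<^sup>+x. ennreal (- ((x - z) \<bullet> v)) \<partial>?V)"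
    by (simp add: ennreal_mult_cancel_left)
  then show "(\<integral>x. (x - z) \<bullet> v \<partial>?V) = 0"
    by (rule integral_eq_0_of_nn_integral_eq)
qed

lemma AE_uniform_in_K:
  "AE x in uniform_measure lborel K. x \<in> K"
  "AE x in uniform_measure (surface_measure K) (frontier K). x \<in> K"
proof -
  have "frontier K \<subseteq> K" using compact by (simp add: compact_imp_closed frontier_subset_eq)
  then show "AE x in uniform_measure (surface_measure K) (frontier K). x \<in> K"
    by (intro AE_uniform_measureI) auto
qed (auto intro: AE_uniform_measureI)

end

section \<open>Independent random points\<close>

text \<open>Expand the square about \<open>c\<close>. By independence the cross term factors, and it
  vanishes once one factor has mean 0, hence the condition on \<open>U\<close> alone. Boundedness
  supplies integrability.\<close>

lemma (in prob_space) expectation_dist_square_indep: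
  fixes U V :: "'a \<Rightarrow> 'b::euclidean_space"
  assumes ind: "indep_var borel U borel V" and K: "bounded K"
    and U: "AE \<omega> in M. U \<omega> \<in> K" and V: "AE \<omega> in M. V \<omega> \<in> K"
    and centred: "\<And>b. expectation (\<lambda>\<omega>. (U \<omega> - c) \<bullet> b) = 0"
  shows "expectation (\<lambda>\<omega>. (dist (U \<omega>) (V \<omega>))\<^sup>2) =
    expectation (\<lambda>\<omega>. (norm (U \<omega> - c))\<^sup>2) + expectation (\<lambda>\<omega>. (norm (V \<omega> - c))\<^sup>2)"
proof -
  have [measurable]: "random_variable borel U" "random_variable borel V"
    using ind by (auto simp: indep_var_eq)
  obtain R where R: "\<And>x. x \<in> K \<Longrightarrow> norm (x - c) \<le> R"
    using K bounded_any_center[of K c] by (auto simp: dist_norm norm_minus_commute)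
  have norm_int: "integrable M (\<lambda>\<omega>. (norm (W \<omega> - c))\<^sup>2)"
    and comp_int: "integrable M (\<lambda>\<omega>. (W \<omega> - c) \<bullet> b)"
    if [measurable]: "random_variable borel W" and W: "AE \<omega> in M. W \<omega> \<in> K" for W b
  proof -
    show "integrable M (\<lambda>\<omega>. (norm (W \<omega> - c))\<^sup>2)"
      using W by (intro integrable_const_bound[where B = "R\<^sup>2"]) (auto intro!: power_mono R elim!: eventually_mono)
    show "integrable M (\<lambda>\<omega>. (W \<omega> - c) \<bullet> b)"
    proof (intro integrable_const_bound[where B = "R * norm b"])
      show "AE \<omega> in M. norm ((W \<omega> - c) \<bullet> b) \<le> R * norm b"
        using W
      proof eventually_elim
        case (elim \<omega>)
        then show ?case
          using order_trans[OF Cauchy_Schwarz_ineq2 mult_right_mono[OF R[OF elim] norm_ge_zero]] by simp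
      qed
    qed simp
  qed
  \<comment> \<open>The product rule for independent variables concerns scalar functions, so it is
    applied to coordinates; the sum over \<open>Basis\<close> recovers the inner product.\<close>
  have prod: "integrable M (\<lambda>\<omega>. ((U \<omega> - c) \<bullet> b) * ((V \<omega> - c) \<bullet> b))"
    "expectation (\<lambda>\<omega>. ((U \<omega> - c) \<bullet> b) * ((V \<omega> - c) \<bullet> b)) = 0" for b
  proof -
    have "indep_var borel (\<lambda>\<omega>. (U \<omega> - c) \<bullet> b) borel (\<lambda>\<omega>. (V \<omega> - c) \<bullet> b)"
      using indep_var_compose[OF ind, of "\<lambda>x. (x - c) \<bullet> b" borel "\<lambda>x. (x - c) \<bullet> b" borel]
      by (simp add: comp_def)
    note * = this comp_int[OF _ U] comp_int[OF _ V]
    show "integrable M (\<lambda>\<omega>. ((U \<omega> - c) \<bullet> b) * ((V \<omega> - c) \<bullet> b))"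
      by (rule indep_var_integrable) (use * in auto)
    show "expectation (\<lambda>\<omega>. ((U \<omega> - c) \<bullet> b) * ((V \<omega> - c) \<bullet> b)) = 0"
      by (subst indep_var_lebesgue_integral) (use * centred in auto)
  qed
  have eq: "(dist (U \<omega>) (V \<omega>))\<^sup>2 = (norm (U \<omega> - c))\<^sup>2 + (norm (V \<omega> - c))\<^sup>2 -
      2 * (\<Sum>b\<in>Basis. ((U \<omega> - c) \<bullet> b) * ((V \<omega> - c) \<bullet> b))" for \<omega>
  proof -
    have "(\<Sum>b\<in>Basis. ((U \<omega> - c) \<bullet> b) * ((V \<omega> - c) \<bullet> b)) = (U \<omega> - c) \<bullet> (V \<omega> - c)"
      by (rule euclidean_inner[symmetric])
    moreover have "dist (U \<omega>) (V \<omega>) = norm ((U \<omega> - c) - (V \<omega> - c))" by (simp add: dist_norm)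
    ultimately show ?thesis
      by (simp only: power2_norm_eq_inner inner_diff_left inner_diff_right)
        (simp add: inner_commute algebra_simps)
  qed
  show ?thesis
    unfolding eq using norm_int[OF _ U] norm_int[OF _ V] prod by simp
qed

text \<open>The family is grouped into the disjoint blocks \<open>{i}\<close> and
  \<open>{j}\<close>, and each block is then evaluated at its only index.\<close>

lemma (in prob_space) indep_vars_imp_indep_var:
  assumes "indep_vars M' X I" "i \<in> I" "j \<in> I" "i \<noteq> j"
  shows "indep_var (M' i) (X i) (M' j) (X j)"
proof -
  have "indep_var (M' i) ((\<lambda>f. f i) \<circ> (\<lambda>\<omega>. restrict (\<lambda>i. X i \<omega>) {i}))
      (M' j) ((\<lambda>f. f j) \<circ> (\<lambda>\<omega>. restrict (\<lambda>i. X i \<omega>) {j}))"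
    using assms by (intro indep_var_compose[OF indep_var_restrict[OF assms(1)]]) auto
  then show ?thesis by (simp add: comp_def)
qed

theorem corollary4:
  fixes K :: "(real ^ 'n) set" and c :: "real ^ 'n"
    and M :: "'w measure" and X X' Y Y' :: "'w \<Rightarrow> real ^ 'n"
    and d :: real
  defines "d \<equiv> real CARD('n)"
  assumes "polytope K" and "interior K \<noteq> {}"
    and "circumscribed K"
    and "centrally_symmetric K c"
    and "prob_space M"
    and "distr M borel X = uniform_measure lborel K"
    and "distr M borel X' = uniform_measure lborel K"
    and "distr M borel Y = uniform_measure (surface_measure K) (frontier K)"
    and "distr M borel Y' = uniform_measure (surface_measure K) (frontier K)"
    and "prob_space.indep_vars M (\<lambda>_. borel) (\<lambda>i. [X, X', Y, Y'] ! i) {..<4::nat}"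
  shows "(\<integral>\<omega>. (dist (X \<omega>) (X' \<omega>))\<^sup>2 \<partial>M) = d / (d + 1) * (\<integral>\<omega>. (dist (X \<omega>) (Y \<omega>))\<^sup>2 \<partial>M)
    \<and> d / (d + 1) * (\<integral>\<omega>. (dist (X \<omega>) (Y \<omega>))\<^sup>2 \<partial>M) = 2 * d / (d + 2) * (\<integral>\<omega>. (dist c (Y \<omega>))\<^sup>2 \<partial>M)
    \<and> 2 * d / (d + 2) * (\<integral>\<omega>. (dist c (Y \<omega>))\<^sup>2 \<partial>M) = d / (d + 2) * (\<integral>\<omega>. (dist (Y \<omega>) (Y' \<omega>))\<^sup>2 \<partial>M)"
proof -
  interpret prob_space M by fact
  obtain z r where zr: "0 < r" "cball z r \<subseteq> K"
    "\<And>F. F facet_of K \<Longrightarrow> tangent_hyperplane (affine hull F) z r"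
    using \<open>circumscribed K\<close> unfolding circumscribed_def by blast
  interpret inscribed_ball K z r
    using zr \<open>polytope K\<close> by unfold_locales auto
  have c: "c = z" using center_of_symmetry \<open>centrally_symmetric K c\<close> by blast
  have sym: "centrally_symmetric K z" using \<open>centrally_symmetric K c\<close> c by simp
  let ?U = "uniform_measure lborel K" and ?V = "uniform_measure (surface_measure K) (frontier K)"
  define A where "A = (\<integral>x. (norm (x - z))\<^sup>2 \<partial>?U)"
  define B where "B = (\<integral>x. (norm (x - z))\<^sup>2 \<partial>?V)"
  have AB: "A = d / (d + 2) * B"
    unfolding A_def B_def using second_moment_uniform by (simp add: d_def)
  have ind: "indep_var borel ([X, X', Y, Y'] ! i) borel ([X, X', Y, Y'] ! j)"
    if "i < 4" "j < 4" "i \<noteq> j" for i j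
    using indep_vars_imp_indep_var[OF assms(11), of i j] that by simp
  have XX': "indep_var borel X borel X'" and XY: "indep_var borel X borel Y"
    and YY': "indep_var borel Y borel Y'"
    using ind[of 0 1] ind[of 0 2] ind[of 2 3] by simp_all
  have [measurable]: "random_variable borel X" "random_variable borel X'"
    "random_variable borel Y" "random_variable borel Y'"
    using XX' YY' by (auto simp: indep_var_eq)
  have transfer: "expectation (\<lambda>\<omega>. f (W \<omega>)) = (\<integral>x. f x \<partial>\<mu>)"
    if "distr M borel W = \<mu>" "random_variable borel W" "f \<in> borel_measurable borel"
    for W \<mu> and f :: "real ^ 'n \<Rightarrow> real"
    unfolding that(1)[symmetric] using that(2,3) by (simp add: integral_distr)
  have inK: "AE \<omega> in M. W \<omega> \<in> K"
    if "distr M borel W = \<mu>" "random_variable borel W" "AE x in \<mu>. x \<in> K" for W \<mu>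
    using that by (subst AE_distr_iff[of W M borel, symmetric]) auto
  note inK = inK[OF assms(7) _ AE_uniform_in_K(1)] inK[OF assms(8) _ AE_uniform_in_K(1)]
    inK[OF assms(9) _ AE_uniform_in_K(2)] inK[OF assms(10) _ AE_uniform_in_K(2)]
  note moment = transfer[OF assms(7), of "\<lambda>x. (norm (x - z))\<^sup>2", folded A_def]
    transfer[OF assms(8), of "\<lambda>x. (norm (x - z))\<^sup>2", folded A_def]
    transfer[OF assms(9), of "\<lambda>x. (norm (x - z))\<^sup>2", folded B_def]
    transfer[OF assms(10), of "\<lambda>x. (norm (x - z))\<^sup>2", folded B_def]
  have centred: "expectation (\<lambda>\<omega>. (X \<omega> - z) \<bullet> b) = 0" "expectation (\<lambda>\<omega>. (Y \<omega> - z) \<bullet> b) = 0" for b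
    using transfer[OF assms(7), of "\<lambda>x. (x - z) \<bullet> b"] transfer[OF assms(9), of "\<lambda>x. (x - z) \<bullet> b"]
      first_moment_uniform_eq_0[OF sym, of b] by simp_all
  note square = expectation_dist_square_indep[OF _ compact_imp_bounded[OF compact]]
  have dists: "expectation (\<lambda>\<omega>. (dist (X \<omega>) (X' \<omega>))\<^sup>2) = A + A"
      "expectation (\<lambda>\<omega>. (dist (X \<omega>) (Y \<omega>))\<^sup>2) = A + B"
      "expectation (\<lambda>\<omega>. (dist (Y \<omega>) (Y' \<omega>))\<^sup>2) = B + B"
    using square[OF XX' _ _ centred(1)] square[OF XY _ _ centred(1)] square[OF YY' _ _ centred(2)]
      inK moment by simp_all
  have OY: "expectation (\<lambda>\<omega>. (dist c (Y \<omega>))\<^sup>2) = B"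
    using moment(3) by (simp add: c dist_norm norm_minus_commute)
  have "d > 0" by (simp add: d_def)
  \<comment> \<open>All four terms equal 2 * d / (d + 2) * \<open>B\<close>; for the mixed one,
    \<open>A + B\<close> is 2 * (d + 1) / (d + 2) * \<open>B\<close>.\<close>
  then show ?thesis
    unfolding dists OY AB by (simp add: divide_simps) (simp add: algebra_simps)
qed

end
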